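(* Let $R$ be a Noetherian, excellent, reduced, $F$-finite ring containing a field of characteristic $p>0$, let $\mathfrak a\subseteq R$ be an ideal with $\mathfrak a\cap R^\circ\neq\emptyset$, and let $t>0$ be a real number. Suppose that $(R,\mathfrak a^t)$ is sharply $F$-pure. Then $\tau(\mathfrak a^t)$ is a radical ideal.
   Context: Rings are commutative with unit. $R^\circ$ is the set of elements of $R$ not contained in any minimal prime of $R$. $I^{[p^e]}$ is the ideal generated by the $p^e$-th powers of elements of the ideal $I$. Convention: $\mathfrak a^0=R$. $\mathfrak a^t$-tight closure: $I^{*\mathfrak a^t}$ is the set of $z\in R$ for which there exists $c\in R^\circ$ with $c\,\mathfrak a^{\lceil tp^e\rceil}z^{p^e}\subseteq I^{[p^e]}$ for all $e\gg0$. Generalized test ideal: $\tau(\mathfrak a^t)=\bigcap_{J\subseteq R}(J:J^{*\mathfrak a^t})$, $J$ running over all ideals of $R$. $R^{1/p^e}$ is the ring of $p^e$-th roots of elements of the reduced ring $R$, regarded as an $R$-module via $F^e:R\subseteq R^{1/p^e}$. For $f\in R$, $f^{1/p^e}F^e:R\to R^{1/p^e}$ is the $R$-linear map sending $1$ to $f^{1/p^e}$; it splits if it has an $R$-linear left inverse. $(R,\mathfrak a^t)$ is sharply $F$-pure if there exist infinitely many integers $e\ge0$ and associated elements $f_e\in\mathfrak a^{\lceil t(p^e-1)\rceil}$ such that each map $f_e^{1/p^e}F^e:R\to R^{1/p^e}$ splits. *)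

theory Defs
  imports
    Complex_Main
    "HOL-Library.Extended_Nat"
    "HOL-Algebra.Algebra"
    "HOL-Algebra.Indexed_Polynomials"
begin

section \<open>Linear maps and finitely generated modules\<close>

definition linear_maps ::
    "('a, 'm) ring_scheme \<Rightarrow> ('a, 'b, 'n) module_scheme \<Rightarrow> ('a, 'c, 'k) module_scheme \<Rightarrow> ('b \<Rightarrow> 'c) set" where
  "linear_maps R M N =
    {\<phi>. \<phi> \<in> carrier M \<rightarrow> carrier N \<and>
        (\<forall>x\<in>carrier M. \<forall>y\<in>carrier M. \<phi> (x \<oplus>\<^bsub>M\<^esub> y) = \<phi> x \<oplus>\<^bsub>N\<^esub> \<phi> y) \<and>
        (\<forall>r\<in>carrier R. \<forall>x\<in>carrier M. \<phi> (r \<odot>\<^bsub>M\<^esub> x) = r \<odot>\<^bsub>N\<^esub> \<phi> x)}"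

definition fin_gen_module :: "('a, 'm) ring_scheme \<Rightarrow> ('a, 'b, 'n) module_scheme \<Rightarrow> bool" where
  "fin_gen_module R M \<longleftrightarrow>
    (\<exists>A. finite A \<and> A \<subseteq> carrier M \<and>
      (\<forall>x\<in>carrier M. \<exists>c\<in>A \<rightarrow> carrier R. x = (\<Oplus>\<^bsub>M\<^esub>a\<in>A. c a \<odot>\<^bsub>M\<^esub> a)))"

definition ring_as_module :: "('a, 'm) ring_scheme \<Rightarrow> ('a, 'a) module" where
  "ring_as_module R =
    \<lparr>carrier = carrier R, monoid.mult = monoid.mult R, one = one R, ring.zero = ring.zero R,
     add = add R, smult = monoid.mult R\<rparr>"


section \<open>Elementary notions for commutative rings\<close>

definition reduced_ring :: "('a, 'm) ring_scheme \<Rightarrow> bool" where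
  "reduced_ring R \<longleftrightarrow>
    (\<forall>x\<in>carrier R. \<forall>n::nat. x [^]\<^bsub>R\<^esub> n = \<zero>\<^bsub>R\<^esub> \<longrightarrow> x = \<zero>\<^bsub>R\<^esub>)"

definition radical_ideal :: "'a set \<Rightarrow> ('a, 'm) ring_scheme \<Rightarrow> bool" where
  "radical_ideal I R \<longleftrightarrow>
    ideal I R \<and> (\<forall>x\<in>carrier R. \<forall>n::nat. x [^]\<^bsub>R\<^esub> n \<in> I \<longrightarrow> x \<in> I)"

text \<open>The additive order of \<open>1\<close> in the library is \<open>0\<close> when it is infinite, as it should be
  for the characteristic.\<close>

definition contains_field_of_char :: "('a, 'm) ring_scheme \<Rightarrow> nat \<Rightarrow> bool" where
  "contains_field_of_char R p \<longleftrightarrow>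
    (\<exists>K. subfield K R \<and> group.ord (add_monoid (R\<lparr>carrier := K\<rparr>)) \<one>\<^bsub>R\<^esub> = p)"

definition minimal_prime :: "'a set \<Rightarrow> ('a, 'm) ring_scheme \<Rightarrow> bool" where
  "minimal_prime P R \<longleftrightarrow>
    primeideal P R \<and> (\<forall>Q. primeideal Q R \<and> Q \<subseteq> P \<longrightarrow> Q = P)"

definition off_minimal_primes :: "('a, 'm) ring_scheme \<Rightarrow> 'a set" where
  "off_minimal_primes R = {c \<in> carrier R. \<forall>P. minimal_prime P R \<longrightarrow> c \<notin> P}"

text \<open>Powers in the semiring of ideals, so that the zeroth power is the unit ideal.\<close>

abbreviation ideal_power :: "('a, 'm) ring_scheme \<Rightarrow> 'a set \<Rightarrow> nat \<Rightarrow> 'a set" where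
  "ideal_power R I n \<equiv> I [^]\<^bsub>ideals_set R\<^esub> n"


section \<open>Localisation, completion, polynomial rings\<close>

text \<open>The fraction \<open>a/s\<close> is the class of all \<open>(b, t)\<close> with \<open>u (a t - b s) = 0\<close> for some
  \<open>u \<in> S\<close>.\<close>

definition fraction :: "('a, 'm) ring_scheme \<Rightarrow> 'a set \<Rightarrow> 'a \<Rightarrow> 'a \<Rightarrow> ('a \<times> 'a) set" where
  "fraction R S a s =
    {(b, t). b \<in> carrier R \<and> t \<in> S \<and>
      (\<exists>u\<in>S. u \<otimes>\<^bsub>R\<^esub> (a \<otimes>\<^bsub>R\<^esub> t \<ominus>\<^bsub>R\<^esub> b \<otimes>\<^bsub>R\<^esub> s) = \<zero>\<^bsub>R\<^esub>)}"

text \<open>As for \<^const>\<open>rcoset_mult\<close>, the operations are unions over representatives: all members of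
  the union are the same class.\<close>

definition localization :: "('a, 'm) ring_scheme \<Rightarrow> 'a set \<Rightarrow> ('a \<times> 'a) set ring" where
  "localization R S =
    \<lparr>carrier = {fraction R S a s | a s. a \<in> carrier R \<and> s \<in> S},
     monoid.mult = (\<lambda>U V. \<Union>(a, s)\<in>U. \<Union>(b, t)\<in>V. fraction R S (a \<otimes>\<^bsub>R\<^esub> b) (s \<otimes>\<^bsub>R\<^esub> t)),
     one = fraction R S \<one>\<^bsub>R\<^esub> \<one>\<^bsub>R\<^esub>,
     ring.zero = fraction R S \<zero>\<^bsub>R\<^esub> \<one>\<^bsub>R\<^esub>,
     add = (\<lambda>U V. \<Union>(a, s)\<in>U. \<Union>(b, t)\<in>V.
       fraction R S (a \<otimes>\<^bsub>R\<^esub> t \<oplus>\<^bsub>R\<^esub> b \<otimes>\<^bsub>R\<^esub> s) (s \<otimes>\<^bsub>R\<^esub> t))\<rparr>"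

abbreviation local_ring_at :: "('a, 'm) ring_scheme \<Rightarrow> 'a set \<Rightarrow> ('a \<times> 'a) set ring" where
  "local_ring_at R P \<equiv> localization R (carrier R - P)"

text \<open>The inverse limit of the \<open>A / I^n\<close>; compatibility of a sequence of cosets under the
  transition maps is inclusion of each coset in the preceding one.\<close>

definition completion :: "('a, 'm) ring_scheme \<Rightarrow> 'a set \<Rightarrow> (nat \<Rightarrow> 'a set) ring" where
  "completion A I =
    \<lparr>carrier = {s. \<forall>n. s n \<in> carrier (A Quot ideal_power A I n) \<and> s (Suc n) \<subseteq> s n},
     monoid.mult = (\<lambda>s t n. s n \<otimes>\<^bsub>A Quot ideal_power A I n\<^esub> t n),
     one = (\<lambda>n. \<one>\<^bsub>A Quot ideal_power A I n\<^esub>),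
     ring.zero = (\<lambda>n. \<zero>\<^bsub>A Quot ideal_power A I n\<^esub>),
     add = (\<lambda>s t n. s n \<oplus>\<^bsub>A Quot ideal_power A I n\<^esub> t n)\<rparr>"

definition completion_map :: "('a, 'm) ring_scheme \<Rightarrow> 'a set \<Rightarrow> 'a \<Rightarrow> nat \<Rightarrow> 'a set" where
  "completion_map A I a = (\<lambda>n. ideal_power A I n +>\<^bsub>A\<^esub> a)"

text \<open>The polynomial ring in \<open>n\<close> variables, on the carrier of indexed polynomials of the
  library (multisets of variables are the monomials).\<close>

definition poly_ring_vars :: "('a, 'm) ring_scheme \<Rightarrow> nat \<Rightarrow> (nat multiset \<Rightarrow> 'a) ring" where
  "poly_ring_vars R n =
    \<lparr>carrier = ring.indexed_pset R {..<n} (carrier R),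
     monoid.mult = (\<lambda>F G m. \<Oplus>\<^bsub>R\<^esub>k\<in>{k. k \<subseteq># m}. F k \<otimes>\<^bsub>R\<^esub> G (m - k)),
     one = ring.indexed_const R \<one>\<^bsub>R\<^esub>,
     ring.zero = ring.indexed_const R \<zero>\<^bsub>R\<^esub>,
     add = ring.indexed_padd R\<rparr>"


section \<open>Excellent rings\<close>

definition prime_chain :: "('a, 'm) ring_scheme \<Rightarrow> nat \<Rightarrow> (nat \<Rightarrow> 'a set) \<Rightarrow> bool" where
  "prime_chain R n C \<longleftrightarrow> (\<forall>i\<le>n. primeideal (C i) R) \<and> (\<forall>i<n. C i \<subset> C (Suc i))"

definition saturated_chain :: "('a, 'm) ring_scheme \<Rightarrow> nat \<Rightarrow> (nat \<Rightarrow> 'a set) \<Rightarrow> bool" where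
  "saturated_chain R n C \<longleftrightarrow> prime_chain R n C \<and>
    (\<forall>i<n. \<not> (\<exists>Q. primeideal Q R \<and> C i \<subset> Q \<and> Q \<subset> C (Suc i)))"

definition krull_dim :: "('a, 'm) ring_scheme \<Rightarrow> enat" where
  "krull_dim R = Sup {enat n | n. \<exists>C. prime_chain R n C}"

definition regular_local_ring :: "('a, 'm) ring_scheme \<Rightarrow> bool" where
  "regular_local_ring A \<longleftrightarrow> cring A \<and> noetherian_ring A \<and>
    (\<exists>!M. maximalideal M A) \<and>
    (\<exists>G. finite G \<and> G \<subseteq> carrier A \<and> maximalideal (genideal A G) A \<and>
      enat (card G) = krull_dim A)"

definition regular_ring :: "('a, 'm) ring_scheme \<Rightarrow> bool" where
  "regular_ring A \<longleftrightarrow> cring A \<and> noetherian_ring A \<and>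
    (\<forall>P. primeideal P A \<longrightarrow> regular_local_ring (local_ring_at A P))"

definition catenary_ring :: "('a, 'm) ring_scheme \<Rightarrow> bool" where
  "catenary_ring A \<longleftrightarrow>
    (\<forall>P Q. primeideal P A \<and> primeideal Q A \<and> P \<subseteq> Q \<longrightarrow>
      (\<exists>N. \<forall>n C. prime_chain A n C \<and> C 0 = P \<and> C n = Q \<longrightarrow> n \<le> N) \<and>
      (\<forall>m n C D. saturated_chain A m C \<and> C 0 = P \<and> C m = Q \<and>
                  saturated_chain A n D \<and> D 0 = P \<and> D n = Q \<longrightarrow> m = n))"

definition zariski_open :: "('a, 'm) ring_scheme \<Rightarrow> 'a set set \<Rightarrow> bool" where
  "zariski_open A \<U> \<longleftrightarrow>
    (\<exists>I. ideal I A \<and> \<U> = {P. primeideal P A \<and> \<not> I \<subseteq> P})"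

definition open_regular_locus :: "('a, 'm) ring_scheme \<Rightarrow> bool" where
  "open_regular_locus A \<longleftrightarrow>
    zariski_open A {P. primeideal P A \<and> regular_local_ring (local_ring_at A P)}"

text \<open>A \<open>k\<close>-algebra \<open>\<phi> : k \<rightarrow> B\<close> is geometrically regular if \<open>B \<otimes>\<^sub>k L\<close> is regular for every finite
  field extension \<open>L\<close> of \<open>k\<close>. Up to isomorphism the finite extensions are the quotients
  \<open>k[X\<^sub>1, \<dots>, X\<^sub>n] / M\<close> with \<open>M\<close> maximal (Zariski's lemma), and
  \<open>B \<otimes>\<^sub>k (k[X\<^sub>1, \<dots>, X\<^sub>n] / M) = B[X\<^sub>1, \<dots>, X\<^sub>n] / M B[X\<^sub>1, \<dots>, X\<^sub>n]\<close>.\<close>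

definition geometrically_regular ::
    "('a, 'm) ring_scheme \<Rightarrow> ('b, 'n) ring_scheme \<Rightarrow> ('a \<Rightarrow> 'b) \<Rightarrow> bool" where
  "geometrically_regular k B \<phi> \<longleftrightarrow>
    (\<forall>n M. maximalideal M (poly_ring_vars k n) \<longrightarrow>
      regular_ring (poly_ring_vars B n Quot genideal (poly_ring_vars B n) ((\<lambda>F. \<phi> \<circ> F) ` M)))"

text \<open>For a ring homomorphism \<open>h : A \<rightarrow> B\<close> and a prime \<open>Q\<close> of \<open>A\<close>, the residue field \<open>\<kappa>(Q)\<close> is the
  fraction field of \<open>A/Q\<close>, and the fibre \<open>B \<otimes>\<^sub>A \<kappa>(Q)\<close> is the localisation of \<open>B/QB\<close> at the
  image of \<open>A - Q\<close>.\<close>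

definition residue_field :: "('a, 'm) ring_scheme \<Rightarrow> 'a set \<Rightarrow> ('a set \<times> 'a set) set ring" where
  "residue_field A Q = localization (A Quot Q) (carrier (A Quot Q) - {\<zero>\<^bsub>A Quot Q\<^esub>})"

definition fibre_quotient ::
    "('a, 'm) ring_scheme \<Rightarrow> ('b, 'n) ring_scheme \<Rightarrow> ('a \<Rightarrow> 'b) \<Rightarrow> 'a set \<Rightarrow> 'b set ring" where
  "fibre_quotient A B h Q = B Quot genideal B (h ` Q)"

definition fibre_quotient_map ::
    "('a, 'm) ring_scheme \<Rightarrow> ('b, 'n) ring_scheme \<Rightarrow> ('a \<Rightarrow> 'b) \<Rightarrow> 'a set \<Rightarrow> 'a set \<Rightarrow> 'b set" where
  "fibre_quotient_map A B h Q U = (\<Union>a\<in>U. genideal B (h ` Q) +>\<^bsub>B\<^esub> h a)"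

definition fibre_denominators ::
    "('a, 'm) ring_scheme \<Rightarrow> ('b, 'n) ring_scheme \<Rightarrow> ('a \<Rightarrow> 'b) \<Rightarrow> 'a set \<Rightarrow> 'b set set" where
  "fibre_denominators A B h Q =
    fibre_quotient_map A B h Q ` (carrier (A Quot Q) - {\<zero>\<^bsub>A Quot Q\<^esub>})"

definition fibre_ring ::
    "('a, 'm) ring_scheme \<Rightarrow> ('b, 'n) ring_scheme \<Rightarrow> ('a \<Rightarrow> 'b) \<Rightarrow> 'a set
      \<Rightarrow> ('b set \<times> 'b set) set ring" where
  "fibre_ring A B h Q = localization (fibre_quotient A B h Q) (fibre_denominators A B h Q)"

definition fibre_map ::
    "('a, 'm) ring_scheme \<Rightarrow> ('b, 'n) ring_scheme \<Rightarrow> ('a \<Rightarrow> 'b) \<Rightarrow> 'a set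
      \<Rightarrow> ('a set \<times> 'a set) set \<Rightarrow> ('b set \<times> 'b set) set" where
  "fibre_map A B h Q W =
    (\<Union>(U, V)\<in>W. fraction (fibre_quotient A B h Q) (fibre_denominators A B h Q)
      (fibre_quotient_map A B h Q U) (fibre_quotient_map A B h Q V))"

definition geometrically_regular_formal_fibres :: "('a, 'm) ring_scheme \<Rightarrow> 'a set \<Rightarrow> bool" where
  "geometrically_regular_formal_fibres A M \<longleftrightarrow>
    (\<forall>Q. primeideal Q A \<longrightarrow>
      geometrically_regular (residue_field A Q)
        (fibre_ring A (completion A M) (completion_map A M) Q)
        (fibre_map A (completion A M) (completion_map A M) Q))"

text \<open>Grothendieck's definition. Every finitely generated algebra over \<open>R\<close> is isomorphic to some
  \<open>R[X\<^sub>1, \<dots>, X\<^sub>n] / I\<close>.\<close>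

definition excellent_ring :: "('a, 'm) ring_scheme \<Rightarrow> bool" where
  "excellent_ring R \<longleftrightarrow> cring R \<and> noetherian_ring R \<and>
    (\<forall>n I. ideal I (poly_ring_vars R n) \<longrightarrow> catenary_ring (poly_ring_vars R n Quot I)) \<and>
    (\<forall>P M. primeideal P R \<and> maximalideal M (local_ring_at R P) \<longrightarrow>
      geometrically_regular_formal_fibres (local_ring_at R P) M) \<and>
    (\<forall>n I. ideal I (poly_ring_vars R n) \<longrightarrow> open_regular_locus (poly_ring_vars R n Quot I))"


section \<open>Rings of roots and sharp F-purity\<close>

text \<open>\<open>R\<^bsup>1/p^e\<^esup>\<close> for \<open>R\<close> reduced of characteristic \<open>p\<close>: the element \<open>x\<close> of the carrier stands for
  the root \<open>x\<^bsup>1/p^e\<^esup>\<close>. Roots are unique and the Frobenius is additive, so the ring operations are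
  those of \<open>R\<close>; the inclusion of \<open>R\<close> sends \<open>r\<close> to \<open>(r\<^bsup>p^e\<^esup>)\<^bsup>1/p^e\<^esup>\<close>, hence the scalar action.\<close>

definition root_ring :: "('a, 'm) ring_scheme \<Rightarrow> nat \<Rightarrow> nat \<Rightarrow> ('a, 'a) module" where
  "root_ring R p e =
    \<lparr>carrier = carrier R, monoid.mult = monoid.mult R, one = one R, ring.zero = ring.zero R,
     add = add R, smult = (\<lambda>r x. (r [^]\<^bsub>R\<^esub> (p ^ e)) \<otimes>\<^bsub>R\<^esub> x)\<rparr>"

definition F_finite :: "('a, 'm) ring_scheme \<Rightarrow> nat \<Rightarrow> bool" where
  "F_finite R p \<longleftrightarrow> fin_gen_module R (root_ring R p 1)"

text \<open>The \<open>R\<close>-linear map \<open>f\<^bsup>1/p^e\<^esup> F\<^sup>e\<close> sending \<open>1\<close> to \<open>f\<^bsup>1/p^e\<^esup>\<close>.\<close>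

definition root_frobenius :: "('a, 'm) ring_scheme \<Rightarrow> nat \<Rightarrow> nat \<Rightarrow> 'a \<Rightarrow> 'a \<Rightarrow> 'a" where
  "root_frobenius R p e f = (\<lambda>r. r \<odot>\<^bsub>root_ring R p e\<^esub> f)"

definition root_frobenius_splits :: "('a, 'm) ring_scheme \<Rightarrow> nat \<Rightarrow> nat \<Rightarrow> 'a \<Rightarrow> bool" where
  "root_frobenius_splits R p e f \<longleftrightarrow>
    (\<exists>\<phi>\<in>linear_maps R (root_ring R p e) (ring_as_module R).
      \<forall>r\<in>carrier R. \<phi> (root_frobenius R p e f r) = r)"

definition sharply_F_pure :: "('a, 'm) ring_scheme \<Rightarrow> nat \<Rightarrow> 'a set \<Rightarrow> real \<Rightarrow> bool" where
  "sharply_F_pure R p \<aa> t \<longleftrightarrow>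
    infinite {e. \<exists>f\<in>ideal_power R \<aa> (nat \<lceil>t * (real p ^ e - 1)\<rceil>). root_frobenius_splits R p e f}"


section \<open>Tight closure and the generalised test ideal\<close>

definition frobenius_power :: "('a, 'm) ring_scheme \<Rightarrow> nat \<Rightarrow> 'a set \<Rightarrow> nat \<Rightarrow> 'a set" where
  "frobenius_power R p I e = genideal R {x [^]\<^bsub>R\<^esub> (p ^ e) | x. x \<in> I}"

definition tight_closure :: "('a, 'm) ring_scheme \<Rightarrow> nat \<Rightarrow> 'a set \<Rightarrow> real \<Rightarrow> 'a set \<Rightarrow> 'a set" where
  "tight_closure R p \<aa> t I =
    {z \<in> carrier R. \<exists>c\<in>off_minimal_primes R. \<forall>\<^sub>F e in sequentially.
      \<forall>x\<in>ideal_power R \<aa> (nat \<lceil>t * real p ^ e\<rceil>).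
        c \<otimes>\<^bsub>R\<^esub> x \<otimes>\<^bsub>R\<^esub> (z [^]\<^bsub>R\<^esub> (p ^ e)) \<in> frobenius_power R p I e}"

definition colon :: "('a, 'm) ring_scheme \<Rightarrow> 'a set \<Rightarrow> 'a set \<Rightarrow> 'a set" where
  "colon R I N = {r \<in> carrier R. \<forall>x\<in>N. r \<otimes>\<^bsub>R\<^esub> x \<in> I}"

definition test_ideal :: "('a, 'm) ring_scheme \<Rightarrow> nat \<Rightarrow> 'a set \<Rightarrow> real \<Rightarrow> 'a set" where
  "test_ideal R p \<aa> t = (\<Inter>J\<in>{J. ideal J R}. colon R J (tight_closure R p \<aa> t J))"

end

theory Submission
  imports Defs
begin

text \<open>
  Write \<open>q = p\<^sup>e\<close> and \<open>\<tau> = \<tau>(\<aa>\<^sup>t)\<close>. The main point is that \<open>\<tau>\<close> is stable under the maps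
  \<open>d \<mapsto> \<phi>((f d)\<^bsup>1/q\<^esup>)\<close> for every \<open>f \<in> \<aa>\<^bsup>\<lceil>t(q - 1)\<rceil>\<^esup>\<close> and every \<open>R\<close>-linear \<open>\<phi> : R\<^bsup>1/q\<^esup> \<rightarrow> R\<close>
  (lemma \<open>test_ideal_linear_map_closed\<close>). Two facts give this for an ideal \<open>J\<close>:

  \<^item> If \<open>z\<close> lies in the tight closure of \<open>J\<close>, then \<open>f z\<^sup>q\<close> lies in the tight closure of
    \<open>J\<^bsup>[q]\<^esup>\<close>, with the same multiplier \<open>c\<close>. Indeed, \<open>\<lceil>t q q'\<rceil> \<le> \<lceil>t q'\<rceil> + q' \<lceil>t(q - 1)\<rceil>\<close> gives
    \<open>c \<aa>\<^bsup>\<lceil>t q'\<rceil>\<^esup> f\<^bsup>q'\<^esup> z\<^bsup>q q'\<^esup> \<subseteq> J\<^bsup>[q q']\<^esup> \<subseteq> (J\<^bsup>[q]\<^esup>)\<^bsup>[q']\<^esup>\<close> for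
    every sufficiently large power \<open>q'\<close> of \<open>p\<close>.
  \<^item> By linearity, \<open>\<phi>\<close> maps the roots of elements of \<open>J\<^bsup>[q]\<^esup>\<close> into \<open>J\<close>.

  Hence, for \<open>d \<in> \<tau>\<close>, \<open>d f z\<^sup>q \<in> J\<^bsup>[q]\<^esup>\<close>, and so \<open>\<phi>((f d)\<^bsup>1/q\<^esup>) z = \<phi>((d f z\<^sup>q)\<^bsup>1/q\<^esup>) \<in> J\<close>.

  Now let \<open>x\<^sup>n \<in> \<tau>\<close>. Sharp F-purity provides \<open>e\<close> with \<open>q \<ge> n\<close>, an element
  \<open>f \<in> \<aa>\<^bsup>\<lceil>t(q - 1)\<rceil>\<^esup>\<close> and a map \<open>\<phi>\<close> with \<open>\<phi>((f x\<^sup>q)\<^bsup>1/q\<^esup>) = x\<close>. As \<open>x\<^sup>q \<in> \<tau>\<close>, also \<open>x \<in> \<tau>\<close>.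
\<close>

section \<open>Powers of ideals\<close>

context cring
begin

lemma ideal_power_ideal:
  assumes "ideal I R"
  shows "ideal (ideal_power R I n) R"
proof -
  interpret S: comm_monoid "ideals_set R"
    by (rule ideals_set_is_comm_monoid)
  have "I \<in> carrier (ideals_set R)"
    using assms by (simp add: ideals_set_def)
  then have "ideal_power R I n \<in> carrier (ideals_set R)"
    by (rule S.nat_pow_closed)
  then show ?thesis
    by (simp add: ideals_set_def)
qed

lemma ideal_power_add:
  assumes "ideal I R"
  shows "ideal_power R I (m + n) = ideal_power R I m \<cdot> ideal_power R I n"
proof -
  interpret S: comm_monoid "ideals_set R"
    by (rule ideals_set_is_comm_monoid)
  have "I \<in> carrier (ideals_set R)"
    using assms by (simp add: ideals_set_def)
  from S.nat_pow_mult[OF this, of m n] show ?thesis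
    by (simp add: ideals_set_def)
qed

lemma ideal_power_mult_mem:
  assumes "ideal I R" "x \<in> ideal_power R I m" "y \<in> ideal_power R I n"
  shows "x \<otimes> y \<in> ideal_power R I (m + n)"
  unfolding ideal_power_add[OF assms(1)] using assms(2,3) by (rule ideal_prod.prod)

lemma ideal_power_pow_mem:
  assumes "ideal I R" "x \<in> ideal_power R I m"
  shows "x [^] (k::nat) \<in> ideal_power R I (k * m)"
proof (induction k)
  case 0
  then show ?case
    by (simp add: ideals_set_def)
next
  case (Suc k)
  from ideal_power_mult_mem[OF assms(1) Suc assms(2)] show ?case
    by (simp add: add.commute)
qed

lemma ideal_power_antimono:
  assumes "ideal I R" "m \<le> n"
  shows "ideal_power R I n \<subseteq> ideal_power R I m"
proof -
  from assms(2) obtain k where "n = m + k"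
    using le_Suc_ex by blast
  then show ?thesis
    using ideal_power_add[OF assms(1), of m k]
      ideal_prod_inter[OF ideal_power_ideal ideal_power_ideal, OF assms(1) assms(1), of m k]
    by auto
qed


section \<open>Frobenius powers and tight closure\<close>

lemma colon_ideal:
  assumes "ideal J R" "N \<subseteq> carrier R"
  shows "ideal (colon R J N) R"
proof -
  interpret J: ideal J R by fact
  have sub: "x \<in> carrier R" if "x \<in> N" for x
    using that assms(2) by blast
  show ?thesis
  proof (rule idealI)
    show "subgroup (colon R J N) (add_monoid R)"
    proof (rule group.subgroupI)
      show "group (add_monoid R)"
        by (rule add.is_group)
      show "colon R J N \<subseteq> carrier (add_monoid R)"
        by (auto simp: colon_def)
      have "\<zero> \<in> colon R J N"
        using sub by (auto simp: colon_def)
      then show "colon R J N \<noteq> {}"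
        by blast
    next
      fix a assume "a \<in> colon R J N"
      then show "inv\<^bsub>add_monoid R\<^esub> a \<in> colon R J N"
        using sub by (auto simp: colon_def l_minus simp flip: a_inv_def)
    next
      fix a b assume "a \<in> colon R J N" "b \<in> colon R J N"
      then show "a \<otimes>\<^bsub>add_monoid R\<^esub> b \<in> colon R J N"
        using sub by (auto simp: colon_def l_distr)
    qed
  next
    fix a x assume a: "a \<in> colon R J N" and x: "x \<in> carrier R"
    then show "x \<otimes> a \<in> colon R J N"
      using sub by (auto simp: colon_def m_assoc J.I_l_closed)
    with a x show "a \<otimes> x \<in> colon R J N"
      by (auto simp: colon_def m_comm)
  qed (rule ring_axioms)
qed

lemma test_ideal_ideal: "ideal (test_ideal R p \<aa> t) R"
  unfolding test_ideal_def
proof (rule i_Intersect)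
  show "(\<lambda>J. colon R J (tight_closure R p \<aa> t J)) ` {J. ideal J R} \<noteq> {}"
    using oneideal by blast
  fix I assume "I \<in> (\<lambda>J. colon R J (tight_closure R p \<aa> t J)) ` {J. ideal J R}"
  then show "ideal I R"
    by (auto simp: tight_closure_def intro!: colon_ideal)
qed

lemma frobenius_power_ideal:
  assumes "I \<subseteq> carrier R"
  shows "ideal (frobenius_power R p I e) R"
  unfolding frobenius_power_def using assms by (intro genideal_ideal) auto

lemma frobenius_power_pow_mem:
  assumes "I \<subseteq> carrier R" "x \<in> I"
  shows "x [^] (p ^ e) \<in> frobenius_power R p I e"
proof -
  have "{x [^] (p ^ e) | x. x \<in> I} \<subseteq> frobenius_power R p I e"
    unfolding frobenius_power_def using assms(1) by (intro genideal_self) auto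
  then show ?thesis
    using assms(2) by blast
qed

lemma frobenius_power_add_subset:
  assumes "I \<subseteq> carrier R"
  shows "frobenius_power R p I (e + e') \<subseteq> frobenius_power R p (frobenius_power R p I e) e'"
proof -
  have sub: "frobenius_power R p I e \<subseteq> carrier R"
    using frobenius_power_ideal[OF assms] by (rule ideal.axioms(1)[THEN additive_subgroup.a_subset])
  have "x [^] (p ^ (e + e')) \<in> frobenius_power R p (frobenius_power R p I e) e'" if "x \<in> I" for x
  proof -
    have "x [^] (p ^ (e + e')) = (x [^] (p ^ e)) [^] (p ^ e')"
      using that assms by (subst nat_pow_pow) (auto simp: power_add)
    then show ?thesis
      using frobenius_power_pow_mem[OF sub frobenius_power_pow_mem[OF assms that]] by simp
  qed
  then show ?thesis
    unfolding frobenius_power_def[of R p I "e + e'"]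
    by (intro genideal_minimal frobenius_power_ideal sub) blast
qed

lemma tight_closure_mult_pow_mem:
  assumes "ideal \<aa> R" "ideal J R" "z \<in> tight_closure R p \<aa> t J"
    and f: "f \<in> ideal_power R \<aa> (nat \<lceil>t * (real p ^ e - 1)\<rceil>)"
  shows "f \<otimes> z [^] (p ^ e) \<in> tight_closure R p \<aa> t (frobenius_power R p J e)"
proof -
  let ?N = "\<lambda>e. nat \<lceil>t * real p ^ e\<rceil>" and ?M = "nat \<lceil>t * (real p ^ e - 1)\<rceil>"
  interpret J: ideal J R by fact
  have z: "z \<in> carrier R"
    using assms(3) by (simp add: tight_closure_def)
  have carr: "x \<in> carrier R" if "x \<in> ideal_power R \<aa> n" for x n
    using ideal_power_ideal[OF assms(1)] that by (rule ideal.Icarr)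
  obtain c n where c: "c \<in> off_minimal_primes R"
    and n: "\<And>e x. e \<ge> n \<Longrightarrow> x \<in> ideal_power R \<aa> (?N e) \<Longrightarrow>
      c \<otimes> x \<otimes> z [^] (p ^ e) \<in> frobenius_power R p J e"
    using assms(3) unfolding tight_closure_def eventually_sequentially by blast
  have c': "c \<in> carrier R"
    using c by (simp add: off_minimal_primes_def)
  have "c \<otimes> x \<otimes> (f \<otimes> z [^] (p ^ e)) [^] (p ^ e')
      \<in> frobenius_power R p (frobenius_power R p J e) e'"
    if "e' \<ge> n" and x: "x \<in> ideal_power R \<aa> (?N e')" for e' x
  proof -
    have "t * real p ^ (e + e') = t * real p ^ e' + real p ^ e' * (t * (real p ^ e - 1))"
      by (simp add: power_add algebra_simps)
    also have "\<dots> \<le> real (?N e') + real p ^ e' * real ?M"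
      by (intro add_mono mult_left_mono real_nat_ceiling_ge) simp
    also have "\<dots> = real (?N e' + p ^ e' * ?M)"
      by simp
    finally have le: "?N (e + e') \<le> ?N e' + p ^ e' * ?M"
      by (simp only: nat_ceiling_le_eq)
    have "x \<otimes> f [^] (p ^ e') \<in> ideal_power R \<aa> (?N e' + p ^ e' * ?M)"
      using ideal_power_mult_mem[OF assms(1) x ideal_power_pow_mem[OF assms(1) f]] .
    then have "x \<otimes> f [^] (p ^ e') \<in> ideal_power R \<aa> (?N (e + e'))"
      using ideal_power_antimono[OF assms(1) le] by blast
    then have "c \<otimes> (x \<otimes> f [^] (p ^ e')) \<otimes> z [^] (p ^ (e + e')) \<in> frobenius_power R p J (e + e')"
      using n that(1) by simp
    moreover have "c \<otimes> (x \<otimes> f [^] (p ^ e')) \<otimes> z [^] (p ^ (e + e'))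
        = c \<otimes> x \<otimes> (f \<otimes> z [^] (p ^ e)) [^] (p ^ e')"
      using c' carr[OF x] carr[OF f] z
      by (simp add: nat_pow_distrib nat_pow_pow power_add m_assoc)
    ultimately show ?thesis
      using frobenius_power_add_subset[OF J.a_subset] by auto
  qed
  then show ?thesis
    unfolding tight_closure_def eventually_sequentially using c carr[OF f] z by auto
qed


section \<open>Linear maps from the ring of roots\<close>

lemma linear_map_root_ring:
  assumes "\<phi> \<in> linear_maps R (root_ring R p e) (ring_as_module R)"
  shows "x \<in> carrier R \<Longrightarrow> \<phi> x \<in> carrier R"
    and "x \<in> carrier R \<Longrightarrow> y \<in> carrier R \<Longrightarrow> \<phi> (x \<oplus> y) = \<phi> x \<oplus> \<phi> y"
    and "r \<in> carrier R \<Longrightarrow> x \<in> carrier R \<Longrightarrow> \<phi> (r [^] (p ^ e) \<otimes> x) = r \<otimes> \<phi> x"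
  using assms by (auto simp: linear_maps_def root_ring_def ring_as_module_def)

lemma linear_map_frobenius_power:
  assumes \<phi>: "\<phi> \<in> linear_maps R (root_ring R p e) (ring_as_module R)"
    and "ideal J R" "y \<in> frobenius_power R p J e"
  shows "\<phi> y \<in> J"
proof -
  interpret J: ideal J R by fact
  note \<phi>_simps = linear_map_root_ring[OF \<phi>]
  \<comment> \<open>The preimage of \<open>J\<close> need not be an ideal for the multiplication of \<open>R\<^bsup>1/q\<^esup>\<close>; the largest
    ideal that it contains is used instead.\<close>
  define K where "K = {y \<in> carrier R. \<forall>r\<in>carrier R. \<phi> (r \<otimes> y) \<in> J}"
  have "\<phi> \<zero> \<oplus> \<phi> \<zero> = \<phi> \<zero>"
    using \<phi>_simps(2)[of \<zero> \<zero>] by simp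
  then have \<phi>0: "\<phi> \<zero> = \<zero>"
    using \<phi>_simps(1)[of \<zero>] by (metis add.l_cancel_one zero_closed)
  have "ideal K R"
  proof (rule idealI)
    show "subgroup K (add_monoid R)"
    proof (rule group.subgroupI)
      show "group (add_monoid R)"
        by (rule add.is_group)
      show "K \<subseteq> carrier (add_monoid R)"
        by (auto simp: K_def)
      have "\<zero> \<in> K"
        by (auto simp: K_def \<phi>0)
      then show "K \<noteq> {}"
        by blast
    next
      fix a assume a: "a \<in> K"
      have "\<phi> (r \<otimes> \<ominus> a) \<in> J" if r: "r \<in> carrier R" for r
      proof -
        have "r \<otimes> \<ominus> a = (\<ominus> r) \<otimes> a"
          using a r by (simp add: K_def l_minus r_minus)
        then show ?thesis
          using a r by (simp add: K_def)
      qed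
      then show "inv\<^bsub>add_monoid R\<^esub> a \<in> K"
        using a by (auto simp: K_def simp flip: a_inv_def)
    next
      fix a b assume "a \<in> K" "b \<in> K"
      then show "a \<otimes>\<^bsub>add_monoid R\<^esub> b \<in> K"
        by (auto simp: K_def r_distr \<phi>_simps)
    qed
  next
    fix a x assume a: "a \<in> K" and x: "x \<in> carrier R"
    then have "\<phi> (r \<otimes> (x \<otimes> a)) \<in> J" if "r \<in> carrier R" for r
      using that by (simp add: K_def flip: m_assoc)
    with a x show "x \<otimes> a \<in> K"
      by (auto simp: K_def)
    with a x show "a \<otimes> x \<in> K"
      by (auto simp: K_def m_comm)
  qed (rule ring_axioms)
  moreover have "j [^] (p ^ e) \<in> K" if j: "j \<in> J" for j
    using j by (auto simp: K_def m_comm[of _ "j [^] (p ^ e)"] \<phi>_simps J.I_r_closed)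
  ultimately have "frobenius_power R p J e \<subseteq> K"
    unfolding frobenius_power_def by (intro genideal_minimal) auto
  with assms(3) have "\<phi> (\<one> \<otimes> y) \<in> J" "y \<in> carrier R"
    by (auto simp: K_def)
  then show ?thesis
    by simp
qed

lemma test_ideal_linear_map_closed:
  assumes "ideal \<aa> R"
    and \<phi>: "\<phi> \<in> linear_maps R (root_ring R p e) (ring_as_module R)"
    and f: "f \<in> ideal_power R \<aa> (nat \<lceil>t * (real p ^ e - 1)\<rceil>)"
    and d: "d \<in> test_ideal R p \<aa> t"
  shows "\<phi> (f \<otimes> d) \<in> test_ideal R p \<aa> t"
proof -
  note \<phi>_simps = linear_map_root_ring[OF \<phi>]
  have f': "f \<in> carrier R"
    using ideal_power_ideal[OF assms(1)] f by (rule ideal.Icarr)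
  have d': "d \<in> carrier R"
    using test_ideal_ideal d by (rule ideal.Icarr)
  have "\<phi> (f \<otimes> d) \<otimes> z \<in> J" if J: "ideal J R" and z: "z \<in> tight_closure R p \<aa> t J" for J z
  proof -
    have z': "z \<in> carrier R"
      using z by (simp add: tight_closure_def)
    have "ideal (frobenius_power R p J e) R"
      using J by (intro frobenius_power_ideal additive_subgroup.a_subset ideal.axioms(1))
    then have "d \<otimes> (f \<otimes> z [^] (p ^ e)) \<in> frobenius_power R p J e"
      using d tight_closure_mult_pow_mem[OF assms(1) J z f] by (auto simp: test_ideal_def colon_def)
    then have "\<phi> (d \<otimes> (f \<otimes> z [^] (p ^ e))) \<in> J"
      by (rule linear_map_frobenius_power[OF \<phi> J])
    also have "d \<otimes> (f \<otimes> z [^] (p ^ e)) = z [^] (p ^ e) \<otimes> (f \<otimes> d)"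
      using d' f' z' by (simp add: m_ac)
    also have "\<phi> \<dots> = z \<otimes> \<phi> (f \<otimes> d)"
      using d' f' z' by (intro \<phi>_simps) auto
    also have "\<dots> = \<phi> (f \<otimes> d) \<otimes> z"
      using d' f' z' by (simp add: \<phi>_simps m_comm)
    finally show ?thesis .
  qed
  then show ?thesis
    using f' d' by (auto simp: test_ideal_def colon_def \<phi>_simps)
qed

end


section \<open>Radicality of the test ideal\<close>

text \<open>This excludes \<open>p = 1\<close>, for which \<open>p\<^sup>e\<close> would not grow with \<open>e\<close>.\<close>

lemma (in ring) contains_field_of_char_neq_1:
  assumes "contains_field_of_char R p"
  shows "p \<noteq> 1"
proof
  assume "p = 1"
  with assms obtain K where K: "subfield K R"
    and ord: "group.ord (add_monoid (R\<lparr>carrier := K\<rparr>)) \<one> = 1"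
    unfolding contains_field_of_char_def by blast
  interpret K: field "R\<lparr>carrier := K\<rparr>"
    using K by (rule subfield_iff(2))
  have "\<one> = \<zero>"
    using K.add.ord_eq_1[of "\<one>"] K.one_closed ord by simp
  then show False
    using K.one_not_zero by simp
qed

theorem corollary3p15:
  fixes R :: "('a, 'm) ring_scheme" and p :: nat and \<aa> :: "'a set" and t :: real
  assumes "cring R"
    and "noetherian_ring R"
    and "excellent_ring R"
    and "reduced_ring R"
    and "p > 0" and "contains_field_of_char R p"
    and "F_finite R p"
    and "ideal \<aa> R" and "\<aa> \<inter> off_minimal_primes R \<noteq> {}"
    and "t > 0"
    and "sharply_F_pure R p \<aa> t"
  shows "radical_ideal (test_ideal R p \<aa> t) R"
proof -
  interpret cring R by fact
  interpret T: ideal "test_ideal R p \<aa> t" R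
    by (rule test_ideal_ideal)
  have p: "p > 1"
    using assms(5) contains_field_of_char_neq_1[OF assms(6)] by linarith
  have "x \<in> test_ideal R p \<aa> t"
    if x: "x \<in> carrier R" and n: "x [^]\<^bsub>R\<^esub> n \<in> test_ideal R p \<aa> t" for x and n :: nat
  proof -
    obtain e f where "e \<ge> n"
      and f: "f \<in> ideal_power R \<aa> (nat \<lceil>t * (real p ^ e - 1)\<rceil>)"
      and split: "root_frobenius_splits R p e f"
      using assms(11) unfolding sharply_F_pure_def infinite_nat_iff_unbounded_le by blast
    obtain \<phi> where \<phi>: "\<phi> \<in> linear_maps R (root_ring R p e) (ring_as_module R)"
      and \<phi>_split: "\<phi> (x [^]\<^bsub>R\<^esub> (p ^ e) \<otimes>\<^bsub>R\<^esub> f) = x"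
      using split x unfolding root_frobenius_splits_def root_frobenius_def root_ring_def by auto
    have f': "f \<in> carrier R"
      using ideal_power_ideal[OF assms(8)] f by (rule ideal.Icarr)
    have "n \<le> p ^ e"
      using \<open>e \<ge> n\<close> less_exp[of e] power_mono[of 2 p e] p by linarith
    then have "x [^]\<^bsub>R\<^esub> (p ^ e) = x [^]\<^bsub>R\<^esub> n \<otimes>\<^bsub>R\<^esub> x [^]\<^bsub>R\<^esub> (p ^ e - n)"
      using x by (simp add: nat_pow_mult)
    also have "\<dots> \<in> test_ideal R p \<aa> t"
      using n x by (simp add: T.I_r_closed)
    finally have "\<phi> (f \<otimes>\<^bsub>R\<^esub> x [^]\<^bsub>R\<^esub> (p ^ e)) \<in> test_ideal R p \<aa> t"
      by (rule test_ideal_linear_map_closed[OF assms(8) \<phi> f])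
    then show ?thesis
      using \<phi>_split f' x by (simp add: m_comm)
  qed
  then show ?thesis
    using test_ideal_ideal unfolding radical_ideal_def by blast
qed

end
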